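(* Let $0<\rho<1/2$. Let $\mu^{(\rho)}$ be the Bernoulli product measure on $\{0,1\}^{\mathbb Z}$ of density $\rho$, let $V=\{\eta: 0\in P(\eta)\}$, and let $\mu$ be $\mu^{(\rho)}$ conditioned on $V$. For $\eta\in V$ index the points of $P(\eta)$ as $(p_k)_{k\in\mathbb Z}$ with $p_k<p_{k+1}$ for all $k$ and $p_0=0$. Then the random variables $N_k=p_{k+1}-p_k$, $k\in\mathbb Z$, are i.i.d. under $\mu$, with distribution $$\mu(\{N_k=2n+1\})=c_n\,\rho^n(1-\rho)^{n+1},\qquad n=0,1,2,\dots,$$ where $c_n=\frac1{n+1}\binom{2n}n$ is the $n$-th Catalan number.
   Context: For $\eta\in\{0,1\}^{\mathbb Z}$ the height profile $h:\mathbb Z\to\mathbb Z$ is defined by $h(0)=0$ and $h(k)-h(k-1)=(-1)^{\eta(k)}$ for all $k\in\mathbb Z$. $P(\eta)=\{p\in\mathbb Z: h(p)>\sup_{i<p}h(i)\}$. For $\rho<1/2$, $\mu^{(\rho)}$-almost surely $h(i)\to\pm\infty$ as $i\to\pm\infty$, so $P(\eta)$ is unbounded above and below, and $\mu^{(\rho)}(V)>0$. Under $\mu^{(\rho)}$ each site is independently occupied ($\eta(i)=1$) with probability $\rho$. *)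

theory Defs
  imports "HOL-Probability.Probability"
begin

text \<open>Configurations in \<open>{0,1}\<^sup>\<int>\<close> are functions \<open>int \<Rightarrow> bool\<close>, where \<open>True\<close>
  stands for \<open>1\<close> (occupied) and \<open>False\<close> for \<open>0\<close>.\<close>

type_synonym config = "int \<Rightarrow> bool"

definition bernoulli_product :: "real \<Rightarrow> config measure" where
  "bernoulli_product \<rho> = PiM UNIV (\<lambda>_. measure_pmf (bernoulli_pmf \<rho>))"

text \<open>The closed form of the profile determined by \<open>h(0) = 0\<close> and
  \<open>h(k) - h(k-1) = (-1)\<^bsup>\<eta>(k)\<^esup>\<close>; see \<open>height_unique\<close> below.\<close>

definition height :: "config \<Rightarrow> int \<Rightarrow> int" where
  "height \<eta> k =
     (if 0 \<le> k then \<Sum>i\<in>{1..k}. (- 1) ^ of_bool (\<eta> i)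
      else - (\<Sum>i\<in>{k+1..0}. (- 1) ^ of_bool (\<eta> i)))"

lemma height_0: "height \<eta> 0 = 0"
  by (simp add: height_def)

lemma height_step: "height \<eta> k - height \<eta> (k - 1) = (- 1) ^ of_bool (\<eta> k)"
proof (cases "1 \<le> k")
  case True
  then have "{1..k} = insert k {1..k - 1}" by auto
  with True show ?thesis by (simp add: height_def)
next
  case False
  then have "{k..0} = insert k {k + 1..0}" by auto
  with False show ?thesis by (cases "k = 0") (simp_all add: height_def)
qed

lemma height_unique:
  "h = height \<eta> \<longleftrightarrow>
     h 0 = 0 \<and> (\<forall>k. h k - h (k - 1) = (- 1) ^ of_bool (\<eta> k))" (is "_ \<longleftrightarrow> ?R")
proof
  assume "h = height \<eta>"
  then show ?R by (simp add: height_0 height_step)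
next
  assume R: ?R
  have "h k = height \<eta> k" for k
  proof (induction k rule: int_induct[where k = 0])
    case base
    show ?case using R by (simp add: height_0)
  next
    case (step1 i)
    then show ?case using R height_step[of \<eta> "i + 1"] by (metis add_diff_cancel_right' diff_add_cancel)
  next
    case (step2 i)
    have "h i - h (i - 1) = height \<eta> i - height \<eta> (i - 1)"
      using R by (simp only: height_step)
    with step2 show ?case by simp
  qed
  then show "h = height \<eta>" by blast
qed

text \<open>The supremum is taken in the extended reals, since \<open>height \<eta>\<close> need not be
  bounded above on \<open>{..<p}\<close> for every \<open>\<eta>\<close>.\<close>

definition records :: "config \<Rightarrow> int set" where
  "records \<eta> =
     {p. ereal (real_of_int (height \<eta> p)) > (SUP i\<in>{..<p}. ereal (real_of_int (height \<eta> i)))}"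

definition V :: "config set" where
  "V = {\<eta>. 0 \<in> records \<eta>}"

text \<open>For a measurable set of positive probability, \<^const>\<open>uniform_measure\<close> is
  conditioning on that set.\<close>

definition cond_bernoulli :: "real \<Rightarrow> config measure" where
  "cond_bernoulli \<rho> = uniform_measure (bernoulli_product \<rho>) V"

definition is_enumeration :: "int set \<Rightarrow> (int \<Rightarrow> int) \<Rightarrow> bool" where
  "is_enumeration S p \<longleftrightarrow> (\<forall>k. p k < p (k + 1)) \<and> range p = S \<and> p 0 = 0"

lemma is_enumeration_unique:
  assumes "is_enumeration S p" and "is_enumeration S q"
  shows "p = q"
proof -
  have mono: "f i < f j" if "is_enumeration S f" "i < j" for f i j
    using that(2)
  proof (induction j rule: int_gr_induct)
    case base
    then show ?case using that(1) by (simp add: is_enumeration_def)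
  next
    case (step j)
    then show ?case using that(1) by (meson is_enumeration_def order.strict_trans)
  qed
  have up: "f (k + 1) \<ge> g (k + 1)"
    if f: "is_enumeration S f" and g: "is_enumeration S g" and eq: "f k = g k" for f g k
  proof -
    obtain j where j: "f (k + 1) = g j"
      using f g unfolding is_enumeration_def by (metis rangeE rangeI)
    then have "g k < g j" using mono[OF f, of k "k + 1"] eq by simp
    then have "k < j" using mono[OF g] by (metis linorder_neqE not_less_iff_gr_or_eq)
    then show ?thesis using j mono[OF g, of "k + 1" j] by (cases "j = k + 1") auto
  qed
  have dn: "f (k - 1) \<le> g (k - 1)"
    if f: "is_enumeration S f" and g: "is_enumeration S g" and eq: "f k = g k" for f g k
  proof -
    obtain j where j: "f (k - 1) = g j"
      using f g unfolding is_enumeration_def by (metis rangeE rangeI)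
    then have "g j < g k" using mono[OF f, of "k - 1" k] eq by simp
    then have "j < k" using mono[OF g] by (metis linorder_neqE not_less_iff_gr_or_eq)
    then show ?thesis using j mono[OF g, of j "k - 1"] by (cases "j = k - 1") auto
  qed
  have "p k = q k" for k
  proof (induction k rule: int_induct[where k = 0])
    case base
    show ?case using assms by (simp add: is_enumeration_def)
  next
    case (step1 i)
    then show ?case using up assms by (metis order_antisym)
  next
    case (step2 i)
    then show ?case using dn assms by (metis order_antisym)
  qed
  then show ?thesis by blast
qed

text \<open>Meaningful when \<open>0 \<in> records \<eta>\<close> and \<open>records \<eta>\<close> is unbounded above and below;
  for any other \<open>\<eta>\<close> no enumeration exists and the value is a fixed unspecified function.\<close>

definition record_pos :: "config \<Rightarrow> int \<Rightarrow> int" where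
  "record_pos \<eta> = (THE p. is_enumeration (records \<eta>) p)"

definition gap :: "int \<Rightarrow> config \<Rightarrow> int" where
  "gap k \<eta> = record_pos \<eta> (k + 1) - record_pos \<eta> k"

definition catalan :: "nat \<Rightarrow> real" where
  "catalan n = 1 / real (n + 1) * real ((2 * n) choose n)"

end

(*
Almost surely the height tends to -oo on the left and is unbounded on the right, because
P(h(n) <= m) <= z^m r^n with z = 1/(2 rho) > 1 and r = 1/2 + 2 rho (1 - rho) < 1. As h moves by unit
steps, its records are then exactly the first passage points of the levels m in Z, one for each m, and
given 0 in P the point p_k is the record of height k.

For m <= 0 <= l, prescribing V and the gaps N_k = a_k for m <= k < l amounts to requiring that q_m is
a record and that the path makes a first passage to the next level on each interval (q_k, q_(k+1)], where
q_0 = 0 and q_(k+1) - q_k = a_k. These events depend on disjoint sets of sites, so by shift invariance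
the probability is P(V) times the product of the weights w(a_k) = P(first passage at time a_k).
Summing out coordinates extends the product formula to all finite index sets. The weights are computed
by conditioning on the last step, which yields the ballot recursion.
*)
theory Submission
  imports Defs
begin

subsection \<open>Records and first passages\<close>

lemma height_add_one: "height \<eta> (k + 1) = height \<eta> k + (if \<eta> (k + 1) then - 1 else 1)"
  using height_step[of \<eta> "k + 1"] by auto

lemma height_le_Suc: "height \<eta> k \<le> height \<eta> (k - 1) + 1"
  using height_add_one[of \<eta> "k - 1"] by (auto split: if_splits)

text \<open>By uniqueness of the profile: the recentred right-hand side starts at 0 and has the
  increments of the shifted configuration.\<close>

lemma height_shift: "height (\<lambda>i. \<eta> (i + s)) k = height \<eta> (k + s) - height \<eta> s"
proof -
  have "(\<lambda>k. height \<eta> (k + s) - height \<eta> s) = height (\<lambda>i. \<eta> (i + s))"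
    unfolding height_unique using height_step[of \<eta> "_ + s"] by (simp add: algebra_simps)
  then show ?thesis by metis
qed

text \<open>Increments read only the sites in \<open>{s<..t}\<close>; the locality statements below
  rest on this.\<close>

lemma height_diff_cong:
  assumes "s \<le> t" and "\<forall>i\<in>{s<..t}. \<eta> i = \<eta>' i"
  shows "height \<eta> t - height \<eta> s = height \<eta>' t - height \<eta>' s"
  using assms
proof (induction t rule: int_ge_induct)
  case (step i)
  have "\<forall>j\<in>{s<..i}. \<eta> j = \<eta>' j" "\<eta> (i + 1) = \<eta>' (i + 1)"
    using step.hyps step.prems by auto
  with step.IH show ?case by (auto simp: height_add_one)
qed simp

lemma abs_height_le: "\<bar>height \<eta> (int n)\<bar> \<le> int n"
proof (induction n)
  case 0
  show ?case by (simp add: height_0)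
next
  case (Suc n)
  then show ?case using height_add_one[of \<eta> "int n"] by (auto split: if_splits simp: add.commute)
qed

lemma records_iff: "p \<in> records \<eta> \<longleftrightarrow> (\<forall>i<p. height \<eta> i < height \<eta> p)"
proof
  assume "p \<in> records \<eta>"
  then have "ereal (real_of_int (height \<eta> i)) < ereal (real_of_int (height \<eta> p))" if "i < p" for i
    using that le_less_trans[OF SUP_upper[of i "{..<p}"]] unfolding records_def by blast
  then show "\<forall>i<p. height \<eta> i < height \<eta> p" by simp
next
  assume *: "\<forall>i<p. height \<eta> i < height \<eta> p"
  \<comment> \<open>Heights are integers, so the strict bounds leave a margin of 1 that survives the
    supremum.\<close>
  have "(SUP i\<in>{..<p}. ereal (real_of_int (height \<eta> i))) \<le> ereal (real_of_int (height \<eta> p - 1))"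
    using * by (intro SUP_least) (auto simp: Suc_le_eq)
  also have "\<dots> < ereal (real_of_int (height \<eta> p))" by simp
  finally show "p \<in> records \<eta>" by (simp add: records_def)
qed

lemma height_less_iff_records:
  assumes "p \<in> records \<eta>" and "q \<in> records \<eta>"
  shows "height \<eta> p < height \<eta> q \<longleftrightarrow> p < q"
  using assms by (metis records_iff linorder_neqE not_less_iff_gr_or_eq)

lemma height_inj_on_records: "inj_on (height \<eta>) (records \<eta>)"
  by (rule inj_onI) (metis height_less_iff_records linorder_neqE less_irrefl)

text \<open>The first site of height at least \<open>m\<close> is a record, and unit steps cannot
  overshoot \<open>m\<close>.\<close>

lemma ex_record_at_level:
  assumes "\<forall>i<l. height \<eta> i < m" and "m \<le> height \<eta> j"
  shows "\<exists>p\<in>records \<eta>. height \<eta> p = m"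
proof -
  \<comment> \<open>Nothing left of \<open>l\<close> reaches \<open>m\<close>, so the first such
    site is \<open>l + int n\<close> with a natural \<open>n\<close>.\<close>
  define n where "n = (LEAST n. m \<le> height \<eta> (l + int n))"
  have "l \<le> j" using assms by (meson linorder_not_le)
  then have ex: "m \<le> height \<eta> (l + int (nat (j - l)))" using assms(2) by simp
  have n: "m \<le> height \<eta> (l + int n)"
    unfolding n_def by (rule LeastI) (rule ex)
  have below: "height \<eta> i < m" if "i < l + int n" for i
  proof (cases "i < l")
    case False
    then have "nat (i - l) < n" "i = l + int (nat (i - l))" using that by auto
    then show ?thesis using not_less_Least[of "nat (i - l)" "\<lambda>n. m \<le> height \<eta> (l + int n)"]
      unfolding n_def by (metis linorder_not_le)
  qed (use assms in auto)
  have "height \<eta> (l + int n) = m"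
    using n below[of "l + int n - 1"] height_le_Suc[of \<eta> "l + int n"] by linarith
  with below show ?thesis by (intro bexI[of _ "l + int n"]) (auto simp: records_iff)
qed

section \<open>Configurations with a record on every level\<close>

definition full_records :: "config set" where
  "full_records = {\<eta>. 0 \<in> records \<eta> \<and> (\<forall>m. \<exists>p\<in>records \<eta>. height \<eta> p = m)}"

text \<open>Records are ordered by height and each level carries exactly one, so listing them by
  height is an enumeration; \<open>height \<eta> 0 = 0\<close> makes index and height agree.\<close>

lemma full_records_record_pos:
  assumes "\<eta> \<in> full_records"
  shows "is_enumeration (records \<eta>) (record_pos \<eta>)" (is ?enum)
    and "record_pos \<eta> k = p \<longleftrightarrow> p \<in> records \<eta> \<and> height \<eta> p = k"
proof -
  have "\<forall>k. \<exists>q. q \<in> records \<eta> \<and> height \<eta> q = k"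
    using assms by (auto simp: full_records_def)
  then obtain q where q: "\<And>k. q k \<in> records \<eta>" "\<And>k. height \<eta> (q k) = k"
    by metis
  have q_iff: "q k = p \<longleftrightarrow> p \<in> records \<eta> \<and> height \<eta> p = k" for k p
    using q inj_onD[OF height_inj_on_records] by blast
  have "q k < q (k + 1)" for k
    using height_less_iff_records[of "q k" \<eta> "q (k + 1)"] q by simp
  moreover have "range q = records \<eta>"
    using q q_iff by (metis (no_types, opaque_lifting) image_subset_iff rangeI subsetI subset_antisym)
  moreover have "q 0 = 0"
    using assms by (simp add: q_iff full_records_def height_0)
  ultimately have enum: "is_enumeration (records \<eta>) q"
    by (simp add: is_enumeration_def)
  then have "record_pos \<eta> = q"
    unfolding record_pos_def by (intro the_equality is_enumeration_unique)
  with enum q_iff show ?enum "record_pos \<eta> k = p \<longleftrightarrow> p \<in> records \<eta> \<and> height \<eta> p = k"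
    by auto
qed

text \<open>Heights of enumerated records grow by at least 1 per index, so every level is passed.
  Hence \<open>full_records\<close> is exactly the set on which an enumeration exists.\<close>

lemma full_records_if_enumeration:
  assumes "is_enumeration (records \<eta>) p"
  shows "\<eta> \<in> full_records"
proof -
  have p: "p k \<in> records \<eta>" 
    and p0: "p 0 = 0"
    and lt: "p k < p (k + 1)" for k
    using assms by (auto simp: is_enumeration_def)
  have less: "height \<eta> (p k) < height \<eta> (p (k + 1))" for k
    using height_less_iff_records[OF p p] lt by blast
  have up: "int n \<le> height \<eta> (p (int n))" for n
  proof (induction n)
    case 0 show ?case by (simp add: p0 height_0)
  next
    case (Suc n) then show ?case using less[of "int n"] by (simp add: add.commute)
  qed
  have dn: "height \<eta> (p (- int n)) \<le> - int n" for n
  proof (induction n)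
    case 0 show ?case by (simp add: p0 height_0)
  next
    case (Suc n) then show ?case using less[of "- 1 - int n"] by simp
  qed
  have "\<exists>q\<in>records \<eta>. height \<eta> q = m" for m
  proof (rule ex_record_at_level)
    have "height \<eta> (p (- int (nat \<bar>m\<bar>))) \<le> m" using dn[of "nat \<bar>m\<bar>"] by auto
    then show "\<forall>i<p (- int (nat \<bar>m\<bar>)). height \<eta> i < m" 
      using p[of "- int (nat \<bar>m\<bar>)"] by (auto simp: records_iff)
    show "m \<le> height \<eta> (p (int (nat \<bar>m\<bar>)))" using up[of "nat \<bar>m\<bar>"] by auto
  qed
  moreover have "0 \<in> records \<eta>" using p[of 0] p0 by simp
  ultimately show ?thesis by (simp add: full_records_def)
qed

text \<open>Both \<open>THE\<close> terms describe the same everywhere false predicate. This settles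
  the measurability of \<open>gap\<close> off \<open>full_records\<close>.\<close>

lemma gap_eq_if_not_full_records:
  assumes "\<eta> \<notin> full_records" and "\<eta>' \<notin> full_records"
  shows "gap k \<eta> = gap k \<eta>'"
proof -
  have "is_enumeration (records \<eta>) = is_enumeration (records \<eta>')"
    using assms full_records_if_enumeration by blast
  then show ?thesis by (simp add: gap_def record_pos_def)
qed

section \<open>First passages and prescribed gaps\<close>

definition passage :: "int \<Rightarrow> int \<Rightarrow> config set" where
  "passage s t = {\<eta>. s < t \<and> (\<forall>i\<in>{s..<t}. height \<eta> i \<le> height \<eta> s) \<and> height \<eta> t = height \<eta> s + 1}"

lemma record_passage:
  assumes "s \<in> records \<eta>" and "\<eta> \<in> passage s t"
  shows "t \<in> records \<eta>"
proof -
  have "height \<eta> i < height \<eta> s + 1" if "i < t" for i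
  proof (cases "i < s")
    case True
    then show ?thesis using assms(1) by (auto simp: records_iff intro: less_trans)
  next
    case False
    then have "i \<in> {s..<t}" using that by simp
    then show ?thesis using assms(2) by (auto simp: passage_def)
  qed
  then show ?thesis using assms(2) by (auto simp: passage_def records_iff)
qed

text \<open>The position that gaps \<open>a\<close> force on the point of index \<open>k\<close>
  when index 0 sits at 0; for negative \<open>k\<close> gaps are counted backwards from 0.\<close>

definition gap_sum :: "(int \<Rightarrow> int) \<Rightarrow> int \<Rightarrow> int" where
  "gap_sum a k = (if 0 \<le> k then \<Sum>i\<in>{0..<k}. a i else - (\<Sum>i\<in>{k..<0}. a i))"

lemma gap_sum_0: "gap_sum a 0 = 0"
  by (simp add: gap_sum_def)

lemma gap_sum_add_one: "gap_sum a (k + 1) = gap_sum a k + a k"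
proof (cases "0 \<le> k")
  case True
  then have "{0..<k + 1} = insert k {0..<k}" by auto
  with True show ?thesis by (simp add: gap_sum_def)
next
  case False
  then have "{k..<0} = insert k {k + 1..<0}" by auto
  with False show ?thesis by (cases "k = -1") (simp_all add: gap_sum_def)
qed

text \<open>A passage carries a record to a record one level higher, so a record at the left end
  propagates along the chain.\<close>

lemma passage_chain_records:
  assumes "gap_sum a m \<in> records \<eta>"
    and "\<forall>k\<in>{m..<l}. \<eta> \<in> passage (gap_sum a k) (gap_sum a (k + 1))"
    and "m \<le> k" and "k \<le> l"
  shows "gap_sum a k \<in> records \<eta> \<and> height \<eta> (gap_sum a k) = height \<eta> (gap_sum a m) + (k - m)"
  using assms(3,4)
proof (induction k rule: int_ge_induct)
  case (step k)
  then have "\<eta> \<in> passage (gap_sum a k) (gap_sum a (k + 1))" using assms(2) by simp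
  with step show ?case using record_passage by (auto simp: passage_def)
qed (use assms(1) in simp)

text \<open>Turns a condition on indexed points into local events. The bounds on \<open>m\<close>
  and \<open>l\<close> keep position 0, whose index and height are known, inside the chain.\<close>

lemma gaps_eq_iff:
  assumes full: "\<eta> \<in> full_records" and "m \<le> 0" and "0 \<le> l"
  shows "(\<forall>k\<in>{m..<l}. gap k \<eta> = a k) \<longleftrightarrow>
    gap_sum a m \<in> records \<eta> \<and> (\<forall>k\<in>{m..<l}. \<eta> \<in> passage (gap_sum a k) (gap_sum a (k + 1)))"
proof (intro iffI conjI ballI)
  note rp = full_records_record_pos(2)[OF full]
  have rp_rec: "record_pos \<eta> k \<in> records \<eta>" "height \<eta> (record_pos \<eta> k) = k" for k
    using rp by blast+
  have rp0: "record_pos \<eta> 0 = 0"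
    using full_records_record_pos(1)[OF full] by (simp add: is_enumeration_def)
  {
    \<comment> \<open>The gaps fix the positions step by step from index 0, upwards to
      \<open>l\<close> and downwards to \<open>m\<close>.\<close>
    assume gaps: "\<forall>k\<in>{m..<l}. gap k \<eta> = a k"
    have up: "k \<le> l \<longrightarrow> record_pos \<eta> k = gap_sum a k" if "0 \<le> k" for k
      using that
    proof (induction k rule: int_ge_induct)
      case (step k)
      have "gap k \<eta> = a k" if "k + 1 \<le> l" using gaps \<open>m \<le> 0\<close> \<open>0 \<le> k\<close> that by auto
      with step show ?case by (auto simp: gap_sum_add_one gap_def)
    qed (simp add: gap_sum_0 rp0)
    have dn: "m \<le> k \<longrightarrow> record_pos \<eta> k = gap_sum a k" if "k \<le> 0" for k
      using that
    proof (induction k rule: int_le_induct)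
      case (step k)
      have "gap (k - 1) \<eta> = a (k - 1)" if "m \<le> k - 1" using gaps \<open>0 \<le> l\<close> \<open>k \<le> 0\<close> that by auto
      with step show ?case using gap_sum_add_one[of a "k - 1"] by (auto simp: gap_def)
    qed (simp add: gap_sum_0 rp0)
    have pos: "record_pos \<eta> k = gap_sum a k" if "k \<in> {m..l}" for k
      using up dn that by (cases "0 \<le> k") auto
    show "gap_sum a m \<in> records \<eta>"
      using pos[of m] rp_rec[of m] \<open>m \<le> 0\<close> \<open>0 \<le> l\<close> by simp
    show "\<eta> \<in> passage (gap_sum a k) (gap_sum a (k + 1))" if k: "k \<in> {m..<l}" for k
    proof -
      have "gap_sum a k = record_pos \<eta> k" "gap_sum a (k + 1) = record_pos \<eta> (k + 1)"
        using k by (auto simp: pos)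
      moreover have "record_pos \<eta> k < record_pos \<eta> (k + 1)"
        using full_records_record_pos(1)[OF full] by (simp add: is_enumeration_def)
      moreover have "height \<eta> i \<le> k" if "i < record_pos \<eta> (k + 1)" for i
        using that rp_rec[of "k + 1"] by (auto simp: records_iff)
      ultimately show ?thesis using rp_rec(2) by (auto simp: passage_def)
    qed
  }
  {
    fix k
    assume *: "gap_sum a m \<in> records \<eta> \<and> (\<forall>k\<in>{m..<l}. \<eta> \<in> passage (gap_sum a k) (gap_sum a (k + 1)))"
      and k: "k \<in> {m..<l}"
    \<comment> \<open>The chain reaches position 0 at height 0 after \<open>- m\<close> levels, so
      it starts at height \<open>m\<close>; along it heights then equal indices.\<close>
    have "height \<eta> (gap_sum a m) = m"
      using passage_chain_records[of a m \<eta> l 0] * \<open>m \<le> 0\<close> \<open>0 \<le> l\<close> by (simp add: gap_sum_0 height_0)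
    then have "record_pos \<eta> j = gap_sum a j" if "j \<in> {m..l}" for j
      using passage_chain_records[of a m \<eta> l j] * that by (subst rp) auto
    with k show "gap k \<eta> = a k" by (simp add: gap_def gap_sum_add_one)
  }
qed

subsection \<open>Measurability\<close>

lemma sets_bernoulli_product [measurable_cong]:
  "sets (bernoulli_product \<rho>) = sets (PiM UNIV (\<lambda>_. count_space UNIV))"
  unfolding bernoulli_product_def by (rule sets_PiM_cong) auto

lemma space_bernoulli_product [simp]: "space (bernoulli_product \<rho>) = UNIV"
  by (simp add: bernoulli_product_def space_PiM)

lemma prob_space_bernoulli_product: "prob_space (bernoulli_product \<rho>)"
  by (simp add: bernoulli_product_def prob_space_PiM measure_pmf.prob_space_axioms)

lemma measurable_site [measurable]:
  "(\<lambda>\<eta>. \<eta> i) \<in> measurable (bernoulli_product \<rho>) (count_space UNIV)"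
  by measurable

lemma measurable_height [measurable]:
  "(\<lambda>\<eta>. height \<eta> k) \<in> measurable (bernoulli_product \<rho>) (count_space UNIV)"
proof (induction k rule: int_induct[where k = 0])
  case base
  show ?case by (simp add: height_0)
next
  case (step1 i)
  note step1(2) [measurable]
  have "(\<lambda>\<eta>. height \<eta> (i + 1)) = (\<lambda>\<eta>. if \<eta> (i + 1) then height \<eta> i - 1 else height \<eta> i + 1)"
    by (auto simp: height_add_one)
  then show ?case by simp
next
  case (step2 i)
  note step2(2) [measurable]
  have "(\<lambda>\<eta>. height \<eta> (i - 1)) = (\<lambda>\<eta>. if \<eta> i then height \<eta> i + 1 else height \<eta> i - 1)"
    using height_add_one[of _ "i - 1"] by auto
  then show ?case by simp
qed

lemma measurable_height_less [measurable]:
  "Measurable.pred (bernoulli_product \<rho>) (\<lambda>\<eta>. height \<eta> i < height \<eta> j)"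
proof -
  have "(\<lambda>\<eta>. height \<eta> i < height \<eta> j) = (\<lambda>\<eta>. \<exists>a. height \<eta> i = a \<and> a < height \<eta> j)"
    by auto
  then show ?thesis by simp
qed

lemma measurable_records [measurable]: "Measurable.pred (bernoulli_product \<rho>) (\<lambda>\<eta>. p \<in> records \<eta>)"
  unfolding records_iff by measurable

lemma V_in_sets [measurable]: "V \<in> sets (bernoulli_product \<rho>)"
  using measurable_records[of 0 \<rho>] by (simp add: V_def pred_def)

lemma full_records_in_sets [measurable]: "full_records \<in> sets (bernoulli_product \<rho>)"
proof -
  have "Measurable.pred (bernoulli_product \<rho>)
      (\<lambda>\<eta>. 0 \<in> records \<eta> \<and> (\<forall>m. \<exists>p. p \<in> records \<eta> \<and> height \<eta> p = m))"
    by measurable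
  then show ?thesis by (simp add: full_records_def pred_def Bex_def)
qed

lemma passage_in_sets [measurable]: "passage s t \<in> sets (bernoulli_product \<rho>)"
proof -
  have "passage s t = {\<eta>\<in>space (bernoulli_product \<rho>). s < t \<and> (\<forall>i\<in>{s..<t}. \<not> height \<eta> s < height \<eta> i) \<and>
      (\<exists>a. height \<eta> s = a \<and> height \<eta> t = a + 1)}"
    by (auto simp: passage_def not_less)
  also have "\<dots> \<in> sets (bernoulli_product \<rho>)" by measurable
  finally show ?thesis .
qed

text \<open>On \<open>full_records\<close> the definite description becomes the measurable condition
  that \<open>p\<close> is the record of height \<open>k\<close>.\<close>

lemma measurable_record_pos_eq [measurable]:
  "Measurable.pred (bernoulli_product \<rho>) (\<lambda>\<eta>. \<eta> \<in> full_records \<and> record_pos \<eta> k = p)"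
proof -
  have "(\<lambda>\<eta>. \<eta> \<in> full_records \<and> record_pos \<eta> k = p) =
      (\<lambda>\<eta>. \<eta> \<in> full_records \<and> p \<in> records \<eta> \<and> height \<eta> p = k)"
    using full_records_record_pos(2) by blast
  then show ?thesis by simp
qed

lemma measurable_gap [measurable]: "gap k \<in> measurable (bernoulli_product \<rho>) (count_space UNIV)"
proof -
  obtain c where c: "\<And>\<eta>. \<eta> \<notin> full_records \<Longrightarrow> gap k \<eta> = c"
    using gap_eq_if_not_full_records by metis
  have "Measurable.pred (bernoulli_product \<rho>) (\<lambda>\<eta>. gap k \<eta> = x)" for x
  proof -
    \<comment> \<open>Off \<open>full_records\<close> the gap is the constant \<open>c\<close>; on
      it the event is split over the position \<open>p\<close> of the point of index
      \<open>k\<close>.\<close>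
    have "(\<lambda>\<eta>. gap k \<eta> = x) = (\<lambda>\<eta>. (\<eta> \<notin> full_records \<and> c = x) \<or> (\<exists>p.
        (\<eta> \<in> full_records \<and> record_pos \<eta> k = p) \<and> (\<eta> \<in> full_records \<and> record_pos \<eta> (k + 1) = p + x)))"
      using c by (auto simp: gap_def fun_eq_iff)
    then show ?thesis by (simp only:) measurable
  qed
  then show ?thesis
    by (intro measurable_count_space_eq2_countable[THEN iffD2]) (auto simp: pred_def vimage_def)
qed

subsection \<open>Independence and shift invariance\<close>

definition depends_on :: "config set \<Rightarrow> int set \<Rightarrow> bool" where
  "depends_on A K \<longleftrightarrow> (\<forall>\<eta> \<eta>'. (\<forall>i\<in>K. \<eta> i = \<eta>' i) \<longrightarrow> \<eta> \<in> A \<longrightarrow> \<eta>' \<in> A)"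

text \<open>Independent coordinates have independent restrictions to the disjoint sets
  \<open>K\<close> and \<open>L\<close>, and each event is a preimage under its restriction.\<close>

lemma measure_Int_depends_on:
  assumes [measurable]: "A \<in> sets (bernoulli_product \<rho>)" "B \<in> sets (bernoulli_product \<rho>)"
    and A: "depends_on A K" and B: "depends_on B L" and disj: "K \<inter> L = {}"
  shows "measure (bernoulli_product \<rho>) (A \<inter> B) =
    measure (bernoulli_product \<rho>) A * measure (bernoulli_product \<rho>) B"
proof -
  interpret prob_space "bernoulli_product \<rho>" by (rule prob_space_bernoulli_product)
  \<comment> \<open>The coordinates together form the identity map, so the product measure is their
    joint law and its factors are the marginals.\<close>
  have indep: "indep_vars (\<lambda>_. count_space UNIV) (\<lambda>i \<eta>. \<eta> i) UNIV"
  proof (subst indep_vars_iff_distr_eq_PiM')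
    have "distr (bernoulli_product \<rho>) (count_space UNIV) (\<lambda>\<eta>. \<eta> i) = measure_pmf (bernoulli_pmf \<rho>)" for i
    proof -
      have "distr (bernoulli_product \<rho>) (measure_pmf (bernoulli_pmf \<rho>)) (\<lambda>\<eta>. \<eta> i) = measure_pmf (bernoulli_pmf \<rho>)"
        unfolding bernoulli_product_def by (rule distr_PiM_component) (auto intro: measure_pmf.prob_space_axioms)
      moreover have "distr (bernoulli_product \<rho>) (count_space UNIV) (\<lambda>\<eta>. \<eta> i) =
          distr (bernoulli_product \<rho>) (measure_pmf (bernoulli_pmf \<rho>)) (\<lambda>\<eta>. \<eta> i)"
        by (rule distr_cong) auto
      ultimately show ?thesis by simp
    qed
    moreover have "distr (bernoulli_product \<rho>) (PiM UNIV (\<lambda>_. count_space UNIV)) (\<lambda>\<eta>. \<lambda>i\<in>UNIV. \<eta> i)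
      = distr (bernoulli_product \<rho>) (bernoulli_product \<rho>) (\<lambda>\<eta>. \<eta>)"
      by (intro distr_cong refl) (auto simp: sets_bernoulli_product)
    ultimately show "distr (bernoulli_product \<rho>) (PiM UNIV (\<lambda>_. count_space UNIV)) (\<lambda>\<eta>. \<lambda>i\<in>UNIV. \<eta> i)
      = PiM UNIV (\<lambda>i. distr (bernoulli_product \<rho>) (count_space UNIV) (\<lambda>\<eta>. \<eta> i))"
      by (simp add: bernoulli_product_def[symmetric])
  qed auto
  have ind: "indep_var (PiM K (\<lambda>_. count_space UNIV)) (\<lambda>\<eta>. restrict \<eta> K)
      (PiM L (\<lambda>_. count_space UNIV)) (\<lambda>\<eta>. restrict \<eta> L)"
    using indep_var_restrict[OF indep disj] by simp
  have ext: "\<exists>X'\<in>sets (PiM J (\<lambda>_. count_space UNIV)). X = (\<lambda>\<eta>. restrict \<eta> J) -` X'"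
    if [measurable]: "X \<in> sets (bernoulli_product \<rho>)" and X: "depends_on X J" for X J
  proof -
    \<comment> \<open>\<open>e\<close> fills the sites outside \<open>J\<close> with the default
      \<open>False\<close>; membership in \<open>X\<close> ignores these sites.\<close>
    define e where "e = (\<lambda>\<omega> i. if i \<in> J then \<omega> i else False)"
    have "e \<in> measurable (PiM J (\<lambda>_. count_space UNIV)) (PiM UNIV (\<lambda>_. count_space UNIV))"
      unfolding e_def by (rule measurable_PiM_single') (auto intro!: measurable_If_set)
    then have [measurable]: "e \<in> measurable (PiM J (\<lambda>_. count_space UNIV)) (bernoulli_product \<rho>)"
      by (simp add: measurable_cong_sets[OF refl sets_bernoulli_product])
    have "X = (\<lambda>\<eta>. restrict \<eta> J) -` (e -` X \<inter> space (PiM J (\<lambda>_. count_space UNIV)))"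
    proof (rule set_eqI)
      fix \<eta>
      have "\<forall>i\<in>J. \<eta> i = e (restrict \<eta> J) i" "\<forall>i\<in>J. e (restrict \<eta> J) i = \<eta> i"
        by (auto simp: e_def)
      then have "\<eta> \<in> X \<longleftrightarrow> e (restrict \<eta> J) \<in> X" using X unfolding depends_on_def by blast
      then show "\<eta> \<in> X \<longleftrightarrow> \<eta> \<in> (\<lambda>\<eta>. restrict \<eta> J) -` (e -` X \<inter> space (PiM J (\<lambda>_. count_space UNIV)))"
        by (simp add: space_PiM)
    qed
    then show ?thesis by (rule bexI) measurable
  qed
  obtain A' B' where AB: "A' \<in> sets (PiM K (\<lambda>_. count_space UNIV))" "A = (\<lambda>\<eta>. restrict \<eta> K) -` A'"
      "B' \<in> sets (PiM L (\<lambda>_. count_space UNIV))" "B = (\<lambda>\<eta>. restrict \<eta> L) -` B'"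
    using ext[OF assms(1) A] ext[OF assms(2) B] by blast
  have "measure (bernoulli_product \<rho>) (A \<inter> B) =
      prob ((\<lambda>\<eta>. (restrict \<eta> K, restrict \<eta> L)) -` (A' \<times> B') \<inter> space (bernoulli_product \<rho>))"
    unfolding AB(2,4) by (rule arg_cong[where f = prob]) auto
  also have "\<dots> = prob A * prob B"
    using indep_varD[OF ind AB(1,3)] unfolding AB(2,4) space_bernoulli_product Int_UNIV_right .
  finally show ?thesis .
qed

text \<open>All factors are equal, so reindexing along an injection preserves the product.\<close>

lemma measure_shift:
  assumes [measurable]: "A \<in> sets (bernoulli_product \<rho>)"
  shows "measure (bernoulli_product \<rho>) {\<eta>. (\<lambda>i. \<eta> (i + s)) \<in> A} = measure (bernoulli_product \<rho>) A"
proof -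
  have "distr (bernoulli_product \<rho>) (bernoulli_product \<rho>) (\<lambda>\<eta>. \<lambda>n\<in>UNIV. \<eta> (n + s)) = bernoulli_product \<rho>"
    unfolding bernoulli_product_def
    by (rule distr_PiM_reindex) (auto intro: measure_pmf.prob_space_axioms inj_onI)
  then have "measure (bernoulli_product \<rho>) A =
      measure (distr (bernoulli_product \<rho>) (bernoulli_product \<rho>) (\<lambda>\<eta> n. \<eta> (n + s))) A"
    unfolding restrict_UNIV by (rule arg_cong[where f = "\<lambda>M. measure M A", OF sym])
  also have "\<dots> = measure (bernoulli_product \<rho>) {\<eta>. (\<lambda>i. \<eta> (i + s)) \<in> A}"
    by (subst measure_distr) (auto simp: vimage_def measurable_cong_sets[OF refl sets_bernoulli_product]
      intro!: measurable_PiM_single')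
  finally show ?thesis by simp
qed

lemma measure_site:
  assumes "0 \<le> \<rho>" "\<rho> \<le> 1"
  shows "measure (bernoulli_product \<rho>) {\<eta>. \<eta> i} = \<rho>"
    and "measure (bernoulli_product \<rho>) {\<eta>. \<not> \<eta> i} = 1 - \<rho>"
proof -
  have d: "distr (bernoulli_product \<rho>) (measure_pmf (bernoulli_pmf \<rho>)) (\<lambda>\<eta>. \<eta> i) = measure_pmf (bernoulli_pmf \<rho>)"
    unfolding bernoulli_product_def by (rule distr_PiM_component) (auto intro: measure_pmf.prob_space_axioms)
  have eq: "measure (bernoulli_product \<rho>) {\<eta>. \<eta> i = b} = pmf (bernoulli_pmf \<rho>) b" for b
    by (subst pmf.rep_eq, subst d[symmetric], subst measure_distr) (auto simp: vimage_def)
  show "measure (bernoulli_product \<rho>) {\<eta>. \<eta> i} = \<rho>" using eq[of True] assms by simp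
  show "measure (bernoulli_product \<rho>) {\<eta>. \<not> \<eta> i} = 1 - \<rho>" using eq[of False] assms by simp
qed

section \<open>Locality and shift covariance of records and passages\<close>

lemma depends_on_mono: "depends_on A K \<Longrightarrow> K \<subseteq> L \<Longrightarrow> depends_on A L"
  unfolding depends_on_def by blast

lemma depends_on_Int: "depends_on A K \<Longrightarrow> depends_on B K \<Longrightarrow> depends_on (A \<inter> B) K"
  unfolding depends_on_def by blast

text \<open>For negative \<open>k\<close> the profile reads sites to the right of \<open>k\<close>,
  hence the condition \<open>0 \<le> k\<close>.\<close>

lemma height_cong:
  assumes "\<forall>i\<in>{..k}. \<eta> i = \<eta>' i" and "0 \<le> k"
  shows "height \<eta> k = height \<eta>' k"
  using height_diff_cong[of 0 k \<eta> \<eta>'] assms by (simp add: height_0)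

text \<open>Only increments from \<open>i < p\<close> to \<open>p\<close> matter, and they read no
  site beyond \<open>p\<close>, even for negative \<open>p\<close>.\<close>

lemma depends_on_records: "depends_on {\<eta>. p \<in> records \<eta>} {..p}"
  unfolding depends_on_def
proof (intro allI impI)
  fix \<eta> \<eta>' :: config
  assume eq: "\<forall>i\<in>{..p}. \<eta> i = \<eta>' i" and rec: "\<eta> \<in> {\<eta>. p \<in> records \<eta>}"
  have "height \<eta>' i < height \<eta>' p" if "i < p" for i
  proof -
    have "height \<eta> p - height \<eta> i = height \<eta>' p - height \<eta>' i"
      using eq that by (intro height_diff_cong) auto
    then show ?thesis using rec that by (auto simp: records_iff dest: spec[of _ i])
  qed
  then show "\<eta>' \<in> {\<eta>. p \<in> records \<eta>}" by (simp add: records_iff)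
qed

lemma depends_on_passage: "depends_on (passage s t) {s<..t}"
  unfolding depends_on_def
proof (intro allI impI)
  fix \<eta> \<eta>' :: config
  assume eq: "\<forall>i\<in>{s<..t}. \<eta> i = \<eta>' i" and passage: "\<eta> \<in> passage s t"
  have "height \<eta> i - height \<eta> s = height \<eta>' i - height \<eta>' s" if "i \<in> {s..t}" for i
    using eq that by (intro height_diff_cong) auto
  note diff = this
  have "height \<eta>' i \<le> height \<eta>' s" if "i \<in> {s..<t}" for i
    using diff[of i] passage that by (auto simp: passage_def dest: bspec[of _ _ i])
  then show "\<eta>' \<in> passage s t"
    using diff[of t] passage by (auto simp: passage_def)
qed

lemma records_shift: "(\<lambda>i. \<eta> (i + s)) \<in> V \<longleftrightarrow> s \<in> records \<eta>"
proof -
  have "(\<forall>i<0. height \<eta> (i + s) < height \<eta> s) \<longleftrightarrow> (\<forall>i<s. height \<eta> i < height \<eta> s)"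
    by (metis add_less_same_cancel2 diff_add_cancel)
  then show ?thesis by (simp add: V_def records_iff height_shift)
qed

lemma passage_shift: "(\<lambda>i. \<eta> (i + s)) \<in> passage 0 (t - s) \<longleftrightarrow> \<eta> \<in> passage s t"
proof -
  have "(\<forall>i\<in>{0..<t - s}. height \<eta> (i + s) \<le> height \<eta> s) \<longleftrightarrow> (\<forall>i\<in>{s..<t}. height \<eta> i \<le> height \<eta> s)"
  proof (intro iffI ballI)
    fix i assume *: "\<forall>i\<in>{0..<t - s}. height \<eta> (i + s) \<le> height \<eta> s" "i \<in> {s..<t}"
    then show "height \<eta> i \<le> height \<eta> s" by (auto dest: bspec[of _ _ "i - s"])
  qed auto
  then show ?thesis by (auto simp: passage_def height_shift)
qed

lemma measure_records:
  "measure (bernoulli_product \<rho>) {\<eta>. p \<in> records \<eta>} = measure (bernoulli_product \<rho>) V"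
  using measure_shift[OF V_in_sets, of \<rho> p] by (simp add: records_shift)

lemma measure_passage:
  "measure (bernoulli_product \<rho>) (passage s t) = measure (bernoulli_product \<rho>) (passage 0 (t - s))"
  using measure_shift[OF passage_in_sets, of \<rho> s 0 "t - s"] by (simp add: passage_shift)

text \<open>Induction on the right end: the chain up to \<open>k\<close> reads sites up to
  \<open>gap_sum a k\<close>, the next passage only later ones, so it contributes an independent
  factor.\<close>

lemma measure_passage_chain:
  assumes "m \<le> l"
  shows "measure (bernoulli_product \<rho>)
      ({\<eta>. gap_sum a m \<in> records \<eta>} \<inter> {\<eta>. \<forall>k\<in>{m..<l}. \<eta> \<in> passage (gap_sum a k) (gap_sum a (k + 1))}) =
    measure (bernoulli_product \<rho>) V * (\<Prod>k\<in>{m..<l}. measure (bernoulli_product \<rho>) (passage 0 (a k)))"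
    (is "measure ?M (?C l) = _")
proof -
  have sets [measurable]: "?C k \<in> sets ?M" for k
  proof -
    have "?C k = {\<eta> \<in> space ?M. gap_sum a m \<in> records \<eta> \<and>
        (\<forall>j\<in>{m..<k}. \<eta> \<in> passage (gap_sum a j) (gap_sum a (j + 1)))}"
      by auto
    then show ?thesis by (simp only:) measurable
  qed
  have C_add_one: "?C (k + 1) = ?C k \<inter> passage (gap_sum a k) (gap_sum a (k + 1))" if "m \<le> k" for k
  proof -
    have "{m..<k + 1} = insert k {m..<k}" using that by auto
    then show ?thesis by auto
  qed
  have "depends_on (?C l) {..gap_sum a l} \<and>
    measure ?M (?C l) = measure ?M V * (\<Prod>k\<in>{m..<l}. measure ?M (passage 0 (a k)))"
    using assms
  proof (induction l rule: int_ge_induct)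
    case base
    show ?case using depends_on_records measure_records by simp
  next
    case (step k)
    let ?s = "gap_sum a k" and ?t = "gap_sum a (k + 1)"
    have "measure ?M (?C (k + 1)) = measure ?M (?C k) * measure ?M (passage ?s ?t)"
      unfolding C_add_one[OF step.hyps]
      by (rule measure_Int_depends_on[OF _ _ _ depends_on_passage, where K = "{..?s}"])
        (use step.IH in auto)
    also have "measure ?M (passage ?s ?t) = measure ?M (passage 0 (a k))"
      by (subst measure_passage) (simp add: gap_sum_add_one)
    moreover have "{m..<k + 1} = insert k {m..<k}" using step.hyps by auto
    moreover have "depends_on (?C (k + 1)) {..?t}"
    proof (cases "?s < ?t")
      case True
      then show ?thesis unfolding C_add_one[OF step.hyps]
        by (intro depends_on_Int depends_on_mono[OF depends_on_passage]
            depends_on_mono[OF conjunct1[OF step.IH]]) auto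
    next
      case False
      \<comment> \<open>A prescribed gap \<open>a k \<le> 0\<close> makes the passage, and with it
        the longer chain, empty.\<close>
      then have "passage ?s ?t = {}" by (auto simp: passage_def)
      then show ?thesis unfolding C_add_one[OF step.hyps] by (simp add: depends_on_def)
    qed
    ultimately show ?case using step.IH by simp
  qed
  then show ?thesis ..
qed

text \<open>Conditioning on site \<open>n + 1\<close>, which is independent of the sites up to
  \<open>n\<close>. It drives both the tail bound and the path recursion.\<close>

lemma measure_split_site:
  assumes "0 \<le> \<rho>" "\<rho> \<le> 1"
    and [measurable]: "A \<in> sets (bernoulli_product \<rho>)" "B \<in> sets (bernoulli_product \<rho>)"
    and dep: "depends_on A {..n}" "depends_on B {..n}"
  shows "measure (bernoulli_product \<rho>) {\<eta>. if \<eta> (n + 1) then \<eta> \<in> A else \<eta> \<in> B} =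
    \<rho> * measure (bernoulli_product \<rho>) A + (1 - \<rho>) * measure (bernoulli_product \<rho>) B"
proof -
  interpret prob_space "bernoulli_product \<rho>" by (rule prob_space_bernoulli_product)
  have site: "{\<eta>. \<eta> (n + 1)} \<in> events" "{\<eta>. \<not> \<eta> (n + 1)} \<in> events"
    using measurable_sets[OF measurable_site, of "{True}" "n + 1" \<rho>]
      measurable_sets[OF measurable_site, of "{False}" "n + 1" \<rho>] by (auto simp: vimage_def)
  have "{\<eta>. if \<eta> (n + 1) then \<eta> \<in> A else \<eta> \<in> B} = (A \<inter> {\<eta>. \<eta> (n + 1)}) \<union> (B \<inter> {\<eta>. \<not> \<eta> (n + 1)})"
    by auto
  also have "prob \<dots> = prob (A \<inter> {\<eta>. \<eta> (n + 1)}) + prob (B \<inter> {\<eta>. \<not> \<eta> (n + 1)})"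
    using site by (intro finite_measure_Union) auto
  also have "prob (A \<inter> {\<eta>. \<eta> (n + 1)}) = prob A * \<rho>"
    by (subst measure_Int_depends_on[OF _ _ dep(1), where L = "{n + 1}"])
      (use site in \<open>auto simp: depends_on_def measure_site[OF assms(1,2)]\<close>)
  also have "prob (B \<inter> {\<eta>. \<not> \<eta> (n + 1)}) = prob B * (1 - \<rho>)"
    by (subst measure_Int_depends_on[OF _ _ dep(2), where L = "{n + 1}"])
      (use site in \<open>auto simp: depends_on_def measure_site[OF assms(1,2)]\<close>)
  finally show ?thesis by simp
qed

subsection \<open>Transience of the height profile\<close>

lemma height_le_in_sets [measurable]: "{\<eta>. height \<eta> k \<le> m} \<in> sets (bernoulli_product \<rho>)"
proof -
  have "{\<eta>. height \<eta> k \<le> m} = (\<lambda>\<eta>. height \<eta> k) -` {..m} \<inter> space (bernoulli_product \<rho>)" by auto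
  then show ?thesis using measurable_sets[OF measurable_height, of "{..m}" k \<rho>] by simp
qed

text \<open>An exponential tail bound, by induction through the last step. The base
  \<open>1 / (2 * \<rho>)\<close> exceeds 1, which covers \<open>n = 0\<close>, while the ratio
  stays below 1.\<close>

lemma measure_height_le:
  assumes "0 < \<rho>" "\<rho> < 1 / 2"
  shows "measure (bernoulli_product \<rho>) {\<eta>. height \<eta> (int n) \<le> m} \<le>
    (1 / (2 * \<rho>)) powi m * (1 / 2 + 2 * \<rho> * (1 - \<rho>)) ^ n"
proof (induction n arbitrary: m)
  interpret prob_space "bernoulli_product \<rho>" by (rule prob_space_bernoulli_product)
  case 0
  show ?case
  proof (cases "0 \<le> m")
    case True
    have "prob {\<eta>. height \<eta> (int 0) \<le> m} \<le> 1" by (rule prob_le_1)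
    also have "1 \<le> (1 / (2 * \<rho>)) ^ nat m" using assms by (intro one_le_power) simp
    finally show ?thesis using True by (simp add: power_int_def)
  next
    case False
    then show ?thesis using assms by (simp add: height_0)
  qed
next
  case (Suc n)
  let ?P = "measure (bernoulli_product \<rho>)" and ?z = "1 / (2 * \<rho>)" and ?r = "1 / 2 + 2 * \<rho> * (1 - \<rho>)"
  have dep: "depends_on {\<eta>. height \<eta> (int n) \<le> j} {..int n}" for j
    unfolding depends_on_def mem_Collect_eq by (metis height_cong of_nat_0_le_iff)
  have "{\<eta>. height \<eta> (int (Suc n)) \<le> m} =
      {\<eta>. if \<eta> (int n + 1) then \<eta> \<in> {\<eta>. height \<eta> (int n) \<le> m + 1} else \<eta> \<in> {\<eta>. height \<eta> (int n) \<le> m - 1}}"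
    using height_add_one[of _ "int n"] by (auto simp: add.commute)
  also have "?P \<dots> = \<rho> * ?P {\<eta>. height \<eta> (int n) \<le> m + 1} + (1 - \<rho>) * ?P {\<eta>. height \<eta> (int n) \<le> m - 1}"
    using assms by (intro measure_split_site dep height_le_in_sets) auto
  also have "\<dots> \<le> \<rho> * (?z powi (m + 1) * ?r ^ n) + (1 - \<rho>) * (?z powi (m - 1) * ?r ^ n)"
    using assms by (intro add_mono mult_left_mono Suc.IH) auto
  also have "\<dots> = ?z powi m * ?r ^ n * (\<rho> * ?z + (1 - \<rho>) / ?z)"
    using assms by (simp add: power_int_add power_int_diff algebra_simps)
  \<comment> \<open>One step multiplies the bound by this average: \<open>?z\<close> for an occupied
    site, \<open>1 / ?z\<close> for an empty one.\<close>
  also have "\<rho> * ?z + (1 - \<rho>) / ?z = ?r"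
    using assms by (simp add: field_simps)
  finally show ?case by (simp add: algebra_simps)
qed

lemma summable_measure_height_le:
  assumes "0 < \<rho>" "\<rho> < 1 / 2"
  shows "summable (\<lambda>n. measure (bernoulli_product \<rho>) {\<eta>. height \<eta> (int n) \<le> m})"
proof (rule summable_comparison_test)
  \<comment> \<open>The first inequality rearranges to
    \<open>2 * \<rho> * (1 - \<rho>) < 1 / 2\<close>, which puts the ratio below 1.\<close>
  have "0 < (1 - 2 * \<rho>)\<^sup>2" "0 < \<rho> * (1 - \<rho>)" using assms by simp_all
  then have "norm (1 / 2 + 2 * \<rho> * (1 - \<rho>)) < 1"
    by (simp add: power2_eq_square algebra_simps abs_if)
  then show "summable (\<lambda>n. (1 / (2 * \<rho>)) powi m * (1 / 2 + 2 * \<rho> * (1 - \<rho>)) ^ n)"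
    by (intro summable_mult summable_geometric)
qed (use measure_height_le[OF assms] in auto)

lemma AE_height_at_top:
  assumes "0 < \<rho>" "\<rho> < 1 / 2"
  shows "AE \<eta> in bernoulli_product \<rho>. \<exists>n. m < height \<eta> (int n)"
proof -
  interpret prob_space "bernoulli_product \<rho>" by (rule prob_space_bernoulli_product)
  have "AE \<eta> in bernoulli_product \<rho>. eventually (\<lambda>n. \<eta> \<in> space (bernoulli_product \<rho>) - {\<eta>. height \<eta> (int n) \<le> m}) sequentially"
    by (rule borel_cantelli_AE1) (auto intro: summable_measure_height_le[OF assms] simp: emeasure_eq_measure)
  then show ?thesis
    by eventually_elim (auto simp: eventually_sequentially not_le)
qed

text \<open>Seen from site \<open>- int n\<close>, the origin lies \<open>n\<close> steps ahead at
  height \<open>- height \<eta> (- int n)\<close>. Shift invariance thus transfers the tail bound,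
  and Borel-Cantelli applies again.\<close>

lemma AE_height_at_bot:
  assumes "0 < \<rho>" "\<rho> < 1 / 2"
  shows "AE \<eta> in bernoulli_product \<rho>. \<exists>l. \<forall>i<l. height \<eta> i < m"
proof -
  interpret prob_space "bernoulli_product \<rho>" by (rule prob_space_bernoulli_product)
  have shift: "{\<eta>. (\<lambda>i. \<eta> (i + - int n)) \<in> {\<eta>. height \<eta> (int n) \<le> - m}} = {\<eta>. m \<le> height \<eta> (- int n)}" for n
    by (simp add: height_shift height_0 del: add_uminus_conv_diff)
  have "prob {\<eta>. m \<le> height \<eta> (- int n)} = prob {\<eta>. height \<eta> (int n) \<le> - m}" for n
    unfolding shift[symmetric] by (rule measure_shift) simp
  then have sum: "summable (\<lambda>n. prob {\<eta>. m \<le> height \<eta> (- int n)})"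
    using summable_measure_height_le[OF assms] by simp
  have sets: "{\<eta>. m \<le> height \<eta> (- int n)} \<in> events" for n
  proof -
    have "{\<eta>. m \<le> height \<eta> (- int n)} = space (bernoulli_product \<rho>) - {\<eta>. height \<eta> (- int n) \<le> m - 1}" by auto
    then show ?thesis by (metis sets.compl_sets height_le_in_sets)
  qed
  have "AE \<eta> in bernoulli_product \<rho>. eventually (\<lambda>n. \<eta> \<in> space (bernoulli_product \<rho>) - {\<eta>. m \<le> height \<eta> (- int n)}) sequentially"
    by (rule borel_cantelli_AE1) (auto intro: sum sets simp: emeasure_eq_measure)
  then show ?thesis
  proof eventually_elim
    case (elim \<eta>)
    then obtain N where N: "\<And>n. N \<le> n \<Longrightarrow> height \<eta> (- int n) < m"
      by (auto simp: eventually_sequentially not_le)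
    have "height \<eta> i < m" if "i < - int N" for i
      using N[of "nat (- i)"] that by simp
    then show ?case by blast
  qed
qed

lemma AE_ex_record_at_level:
  assumes "0 < \<rho>" "\<rho> < 1 / 2"
  shows "AE \<eta> in bernoulli_product \<rho>. \<forall>m. \<exists>p\<in>records \<eta>. height \<eta> p = m"
  unfolding AE_all_countable
proof
  fix m
  show "AE \<eta> in bernoulli_product \<rho>. \<exists>p\<in>records \<eta>. height \<eta> p = m"
    using AE_height_at_top[OF assms, of m] AE_height_at_bot[OF assms, of m]
  proof eventually_elim
    case (elim \<eta>)
    then obtain n l where "m < height \<eta> (int n)" "\<forall>i<l. height \<eta> i < m" by blast
    then show ?case by (intro ex_record_at_level[of l _ _ "int n"]) auto
  qed
qed

text \<open>All sites are records with equal probability. Were it zero, almost surely none of the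
  countably many sites would be a record, yet records exist almost surely.\<close>

lemma measure_V_pos:
  assumes "0 < \<rho>" "\<rho> < 1 / 2"
  shows "0 < measure (bernoulli_product \<rho>) V"
proof (rule ccontr)
  interpret prob_space "bernoulli_product \<rho>" by (rule prob_space_bernoulli_product)
  assume "\<not> 0 < prob V"
  then have "prob {\<eta>. p \<in> records \<eta>} = 0" for p
    using measure_nonneg[of "bernoulli_product \<rho>" V] by (simp add: measure_records del: measure_nonneg)
  then have "AE \<eta> in bernoulli_product \<rho>. p \<notin> records \<eta>" for p
    by (intro AE_I[where N = "{\<eta>. p \<in> records \<eta>}"])
      (auto simp: emeasure_eq_measure measurable_records[of p \<rho>, unfolded pred_def, simplified])
  then have "AE \<eta> in bernoulli_product \<rho>. \<forall>p. p \<notin> records \<eta>"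
    unfolding AE_all_countable by blast
  with AE_ex_record_at_level[OF assms] have "AE \<eta> in bernoulli_product \<rho>. False"
    by eventually_elim blast
  then show False by simp
qed

subsection \<open>The law of the first passage time\<close>

text \<open>Number of paths with \<open>u\<close> up-steps and \<open>d\<close> down-steps that never become positive; only
  meaningful for \<open>u \<le> d + 1\<close>, and it vanishes on the boundary \<open>u = d + 1\<close> of the recursion.\<close>

definition ballot :: "nat \<Rightarrow> nat \<Rightarrow> real" where
  "ballot u d = (real d + 1 - real u) / (real d + 1) * real ((u + d) choose u)"

text \<open>All three binomials are linear multiples of \<open>K\<close>, which leaves a rational
  identity in \<open>u\<close> and \<open>d\<close>.\<close>

lemma ballot_Suc_Suc: "ballot (Suc u) (Suc d) = ballot (Suc u) d + ballot u (Suc d)"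
proof -
  define K where "K = fact (u + d + 1) / (fact (Suc u) * fact (Suc d) :: real)"
  have "fact (Suc u + Suc d) = fact (u + d + 1) * (real u + real d + 2)"
    by (simp add: algebra_simps)
  then have 1: "real ((Suc u + Suc d) choose Suc u) = K * (real u + real d + 2)"
    by (subst binomial_fact) (simp_all add: K_def del: fact_Suc add_Suc add_Suc_right)
  have "K * (real d + 1) = fact (u + d + 1) / (fact (Suc u) * fact d)"
    by (simp add: K_def divide_simps)
  then have 2: "real ((Suc u + d) choose Suc u) = K * (real d + 1)"
    by (subst binomial_fact) simp_all
  have "K * (real u + 1) = fact (u + d + 1) / (fact u * fact (Suc d))"
    by (simp add: K_def divide_simps)
  then have 3: "real ((u + Suc d) choose u) = K * (real u + 1)"
    by (subst binomial_fact) simp_all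
  show ?thesis
    unfolding ballot_def 1 2 3 by (simp add: divide_simps) (simp add: algebra_simps)
qed

definition nonpos_path :: "nat \<Rightarrow> int \<Rightarrow> config set" where
  "nonpos_path n j = {\<eta>. (\<forall>i\<in>{0..int n}. height \<eta> i \<le> 0) \<and> height \<eta> (int n) = j}"

lemma nonpos_path_in_sets [measurable]: "nonpos_path n j \<in> sets (bernoulli_product \<rho>)"
proof -
  have "nonpos_path n j = {\<eta>\<in>space (bernoulli_product \<rho>). (\<forall>i\<in>{0..int n}. \<eta> \<in> {\<eta>. height \<eta> i \<le> 0}) \<and> height \<eta> (int n) = j}"
    by (auto simp: nonpos_path_def)
  also have "\<dots> \<in> sets (bernoulli_product \<rho>)" by measurable
  finally show ?thesis .
qed

lemma depends_on_nonpos_path: "depends_on (nonpos_path n j) {..int n}"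
  unfolding depends_on_def
proof (intro allI impI)
  fix \<eta> \<eta>' :: config
  assume eq: "\<forall>i\<in>{..int n}. \<eta> i = \<eta>' i" and path: "\<eta> \<in> nonpos_path n j"
  have "height \<eta>' i = height \<eta> i" if "i \<in> {0..int n}" for i
    using eq that by (intro height_cong) auto
  then show "\<eta>' \<in> nonpos_path n j" using path by (simp add: nonpos_path_def)
qed

text \<open>Induction on the length through the last step. Length and end height determine
  \<open>u\<close> and \<open>d\<close>, and an up-step is an empty site, of weight
  \<open>1 - \<rho>\<close>.\<close>

lemma measure_nonpos_path:
  assumes "0 \<le> \<rho>" "\<rho> \<le> 1" and "u \<le> d + 1"
  shows "measure (bernoulli_product \<rho>) (nonpos_path (u + d) (int u - int d)) = ballot u d * (1 - \<rho>) ^ u * \<rho> ^ d"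
  using assms(3)
proof (induction "u + d" arbitrary: u d)
  interpret prob_space "bernoulli_product \<rho>" by (rule prob_space_bernoulli_product)
  case 0
  have "nonpos_path 0 0 = space (bernoulli_product \<rho>)" by (auto simp: nonpos_path_def height_0)
  then have "prob (nonpos_path 0 0) = 1" by (simp only: prob_space)
  with 0 show ?case by (simp add: ballot_def)
next
  case (Suc n)
  let ?P = "measure (bernoulli_product \<rho>)"
  show ?case
  proof (cases "u = d + 1")
    case True
    \<comment> \<open>The end height would be 1, so no path qualifies; \<open>ballot\<close>
      vanishes here.\<close>
    then have "nonpos_path (u + d) (int u - int d) = {}"
      by (auto simp: nonpos_path_def intro!: bexI[of _ "int (u + d)"])
    with True show ?thesis by (simp add: ballot_def)
  next
    case False
    with Suc.prems Suc.hyps(2) obtain d' where d: "d = Suc d'" by (cases d) auto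
    have n: "n = u + d'" using Suc.hyps(2) d by simp
    let ?j = "int u - int d"
    have ivl: "{0..int (Suc n)} = insert (int n + 1) {0..int n}" by auto
    \<comment> \<open>Now \<open>u \<le> d\<close>, so the end height \<open>?j\<close> is at most 0
      and the constraint at the new site is automatic.\<close>
    have "nonpos_path (Suc n) ?j =
        {\<eta>. if \<eta> (int n + 1) then \<eta> \<in> nonpos_path n (?j + 1) else \<eta> \<in> nonpos_path n (?j - 1)}"
      using False Suc.prems height_add_one[of _ "int n"]
      unfolding nonpos_path_def ivl by (auto simp: add.commute)
    then have rec: "?P (nonpos_path (Suc n) ?j) = \<rho> * ?P (nonpos_path n (?j + 1)) + (1 - \<rho>) * ?P (nonpos_path n (?j - 1))"
      using assms by (simp only:) (rule measure_split_site, auto intro: depends_on_nonpos_path)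
    have down: "?P (nonpos_path n (?j + 1)) = ballot u d' * (1 - \<rho>) ^ u * \<rho> ^ d'"
      using Suc.hyps(1)[OF n] False Suc.prems d by (simp add: n)
    show ?thesis
    proof (cases u)
      case 0
      \<comment> \<open>A final up-step would start at height \<open>- d - 1\<close>, out of reach
        in \<open>d - 1\<close> steps.\<close>
      have "height \<eta> (int n) \<noteq> ?j - 1" for \<eta>
        using abs_height_le[of \<eta> n] 0 n d by auto
      then have "nonpos_path n (?j - 1) = {}" by (auto simp: nonpos_path_def)
      then show ?thesis using rec down Suc.hyps(2) 0 d by (simp add: ballot_def)
    next
      case (Suc u')
      have "?j - 1 = int u' - int d" using Suc by simp
      moreover have "?P (nonpos_path n (int u' - int d)) = ballot u' d * (1 - \<rho>) ^ u' * \<rho> ^ d"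
        using Suc.hyps(1)[of u' d] n Suc.prems d Suc by simp
      ultimately have "?P (nonpos_path n (?j - 1)) = ballot u' d * (1 - \<rho>) ^ u' * \<rho> ^ d"
        by (simp only:)
      with rec down have "?P (nonpos_path (Suc n) ?j) = \<rho> * (ballot u d' * (1 - \<rho>) ^ u * \<rho> ^ d') +
          (1 - \<rho>) * (ballot u' d * (1 - \<rho>) ^ u' * \<rho> ^ d)"
        by (simp only:)
      also have "\<dots> = ballot u d * (1 - \<rho>) ^ u * \<rho> ^ d"
        unfolding Suc d ballot_Suc_Suc by (simp add: algebra_simps)
      finally show ?thesis using Suc.hyps(2) by (simp only:)
    qed
  qed
qed

text \<open>Such a passage is a nonpositive path of length \<open>2 * n\<close> back to 0 and one
  up-step, which gives the extra factor \<open>1 - \<rho>\<close>. Diagonal ballot numbers are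
  Catalan numbers.\<close>

lemma measure_passage_odd:
  assumes "0 \<le> \<rho>" "\<rho> \<le> 1"
  shows "measure (bernoulli_product \<rho>) (passage 0 (2 * int n + 1)) = catalan n * \<rho> ^ n * (1 - \<rho>) ^ (n + 1)"
proof -
  have "passage 0 (2 * int n + 1) = {\<eta>. if \<eta> (int (n + n) + 1) then \<eta> \<in> {} else \<eta> \<in> nonpos_path (n + n) 0}"
  proof -
    have "height \<eta> (2 * int n) \<le> 0 \<Longrightarrow> height \<eta> (2 * int n + 1) = 1 \<longleftrightarrow> \<not> \<eta> (2 * int n + 1) \<and> height \<eta> (2 * int n) = 0" for \<eta>
      using height_add_one[of \<eta> "2 * int n"] by auto
    moreover have "{0..<2 * int n + 1} = {0..2 * int n}" by auto
    ultimately show ?thesis by (auto simp: passage_def nonpos_path_def height_0)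
  qed
  then have "measure (bernoulli_product \<rho>) (passage 0 (2 * int n + 1)) =
      \<rho> * measure (bernoulli_product \<rho>) {} + (1 - \<rho>) * measure (bernoulli_product \<rho>) (nonpos_path (n + n) 0)"
    using assms by (simp only:)
      (rule measure_split_site[OF _ _ _ _ _ depends_on_nonpos_path], auto simp: depends_on_def)
  also have "measure (bernoulli_product \<rho>) (nonpos_path (n + n) 0) = ballot n n * (1 - \<rho>) ^ n * \<rho> ^ n"
    using measure_nonpos_path[OF assms, of n n] by simp
  also have "ballot n n = catalan n"
    by (simp add: ballot_def catalan_def mult_2)
  finally show ?thesis by simp
qed

subsection \<open>Joint law of the gaps\<close>

context prob_space
begin

text \<open>The coordinates in \<open>L\<close> are summed out one at a time, each sum being 1 by
  the normalization of \<open>w\<close>.\<close>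

lemma prob_all_eq_subset:
  fixes X :: "'i \<Rightarrow> 'a \<Rightarrow> 'b::countable" and w :: "'b \<Rightarrow> real"
  assumes X [measurable]: "\<And>i. X i \<in> measurable M (count_space UNIV)"
    and w: "\<And>b. 0 \<le> w b" "(\<integral>\<^sup>+b. ennreal (w b) \<partial>count_space UNIV) = 1"
    and "finite L"
    and "\<And>a. prob {x \<in> space M. \<forall>k\<in>J \<union> L. X k x = a k} = (\<Prod>k\<in>J \<union> L. w (a k))"
    and "finite J"
  shows "prob {x \<in> space M. \<forall>k\<in>J. X k x = a k} = (\<Prod>k\<in>J. w (a k))"
  using assms(4-6)
proof (induction L arbitrary: J a rule: finite_induct)
  case (insert i L)
  note fin = \<open>finite J\<close>
  have un: "insert i J \<union> L = J \<union> insert i L" by auto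
  \<comment> \<open>The induction hypothesis with \<open>i\<close> moved from \<open>L\<close> to
    \<open>J\<close>; if \<open>i\<close> is new, it is then summed out over its values
    \<open>b\<close>.\<close>
  have *: "prob {x \<in> space M. \<forall>k\<in>insert i J. X k x = a k} = (\<Prod>k\<in>insert i J. w (a k))" for a
    by (rule insert.IH) (use fin in \<open>simp_all only: un insert.prems(1) finite_insert\<close>)
  show ?case
  proof (cases "i \<in> J")
    case True
    then show ?thesis using *[of a] by (simp add: insert_absorb)
  next
    case False
    let ?E = "\<lambda>b. {x \<in> space M. \<forall>k\<in>insert i J. X k x = (a(i := b)) k}"
    have E: "?E b \<in> sets M" for b
    proof (rule sets.sets_Collect_finite_All)
      show "{x \<in> space M. X k x = c} \<in> sets M" for k c by measurable
    qed (use fin in simp)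
    have "{x \<in> space M. \<forall>k\<in>J. X k x = a k} = (\<Union>b. ?E b)"
      using False by auto
    then have "emeasure M {x \<in> space M. \<forall>k\<in>J. X k x = a k} = emeasure M (\<Union>b. ?E b)"
      by (simp only:)
    also have "\<dots> = (\<integral>\<^sup>+b. emeasure M (?E b) \<partial>count_space UNIV)"
      by (rule emeasure_UN_countable) (use E in \<open>auto simp: disjoint_family_on_def\<close>)
    also have "\<dots> = (\<integral>\<^sup>+b. ennreal (w b) * ennreal (\<Prod>k\<in>J. w (a k)) \<partial>count_space UNIV)"
    proof (rule nn_integral_cong)
      fix b
      have "(\<Prod>k\<in>J. w ((a(i := b)) k)) = (\<Prod>k\<in>J. w (a k))"
        using False by (intro prod.cong) auto
      then have "prob (?E b) = w b * (\<Prod>k\<in>J. w (a k))"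
        using False fin by (subst *) simp
      then show "emeasure M (?E b) = ennreal (w b) * ennreal (\<Prod>k\<in>J. w (a k))"
        unfolding emeasure_eq_measure using w(1) by (simp add: ennreal_mult prod_nonneg)
    qed
    also have "\<dots> = ennreal (\<Prod>k\<in>J. w (a k))"
      by (simp add: nn_integral_multc w(2))
    finally show ?thesis
      using w(1) by (simp add: emeasure_eq_measure prod_nonneg)
  qed
qed (simp only: Un_empty_right)

text \<open>One-element \<open>J\<close> identify \<open>w\<close> as the common law, so the formula
  is independence of point events, which generate everything on a countable type.\<close>

lemma indep_vars_if_prob_all_eq:
  fixes X :: "'i \<Rightarrow> 'a \<Rightarrow> 'b::countable" and w :: "'b \<Rightarrow> real"
  assumes X [measurable]: "\<And>i. X i \<in> measurable M (count_space UNIV)"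
    and prod: "\<And>J a. finite J \<Longrightarrow> prob {x \<in> space M. \<forall>k\<in>J. X k x = a k} = (\<Prod>k\<in>J. w (a k))"
  shows "indep_vars (\<lambda>_. count_space UNIV) X UNIV"
proof -
  \<comment> \<open>Different values give disjoint events, so adding \<open>{}\<close> makes the
    point events closed under intersection.\<close>
  define F where "F = (\<lambda>i. insert {} (range (\<lambda>b. X i -` {b} \<inter> space M)))"
  have F_sets: "F i \<subseteq> events" for i
    by (auto simp: F_def)
  have "indep_sets F UNIV"
  proof (rule indep_setsI)
    fix A J assume "J \<noteq> {}" and fin: "finite J" and A: "\<forall>j\<in>J. A j \<in> F j"
    show "prob (\<Inter>j\<in>J. A j) = (\<Prod>j\<in>J. prob (A j))"
    proof (cases "\<exists>j\<in>J. A j = {}")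
      case True
      then obtain j where j: "j \<in> J" "A j = {}" by blast
      then have "(\<Inter>j\<in>J. A j) = {}" by blast
      moreover have "(\<Prod>j\<in>J. prob (A j)) = 0"
        using j by (intro prod_zero[OF fin] bexI[of _ j]) simp_all
      ultimately show ?thesis by simp
    next
      case False
      then have "\<forall>j\<in>J. \<exists>b. A j = X j -` {b} \<inter> space M" using A unfolding F_def by blast
      then obtain a where a: "\<And>j. j \<in> J \<Longrightarrow> A j = X j -` {a j} \<inter> space M" by metis
      have "prob (A j) = w (a j)" if "j \<in> J" for j
      proof -
        have "A j = {x \<in> space M. \<forall>k\<in>{j}. X k x = a k}" using a[OF that] by auto
        then show ?thesis using prod[of "{j}" a] by simp
      qed
      moreover have "(\<Inter>j\<in>J. A j) = {x \<in> space M. \<forall>k\<in>J. X k x = a k}"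
        using a \<open>J \<noteq> {}\<close> by auto
      ultimately show ?thesis using prod[OF fin, of a] by simp
    qed
  qed (rule F_sets)
  moreover have "Int_stable (F i)" for i
  proof (rule Int_stableI)
    fix A B assume "A \<in> F i" "B \<in> F i"
    then consider "A \<inter> B = {}" | "A \<inter> B = A" by (auto simp: F_def)
    then show "A \<inter> B \<in> F i" using \<open>A \<in> F i\<close> by cases (auto simp: F_def)
  qed
  ultimately have "indep_sets (\<lambda>i. sigma_sets (space M) (F i)) UNIV"
    by (rule indep_sets_sigma)
  then have "indep_sets (\<lambda>i. {X i -` A \<inter> space M |A. A \<in> sets (count_space UNIV)}) UNIV"
  proof (rule indep_sets_mono_sets)
    fix i
    show "{X i -` A \<inter> space M |A. A \<in> sets (count_space UNIV)} \<subseteq> sigma_sets (space M) (F i)"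
    proof safe
      fix A :: "'b set"
      have "sigma_algebra (space M) (sigma_sets (space M) (F i))"
        using F_sets[of i] sets.space_closed[of M] by (intro sigma_algebra_sigma_sets) (rule subset_trans)
      moreover have "X i -` {b} \<inter> space M \<in> sigma_sets (space M) (F i)" for b
        by (rule sigma_sets.Basic) (simp add: F_def)
      ultimately have "(\<Union>b\<in>A. X i -` {b} \<inter> space M) \<in> sigma_sets (space M) (F i)"
        by (intro sigma_algebra.countable_UN'') simp_all
      moreover have "(\<Union>b\<in>A. X i -` {b} \<inter> space M) = X i -` A \<inter> space M" by auto
      ultimately show "X i -` A \<inter> space M \<in> sigma_sets (space M) (F i)" by simp
    qed
  qed
  then show ?thesis by (simp add: indep_vars_def2)
qed

end

section \<open>The measure conditioned on a record at 0\<close>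

lemma space_cond_bernoulli [simp]: "space (cond_bernoulli \<rho>) = UNIV"
  by (simp add: cond_bernoulli_def)

lemma sets_cond_bernoulli [measurable_cong]: "sets (cond_bernoulli \<rho>) = sets (bernoulli_product \<rho>)"
  by (simp add: cond_bernoulli_def)

lemma emeasure_V:
  assumes "0 < \<rho>" "\<rho> < 1 / 2"
  shows "emeasure (bernoulli_product \<rho>) V \<noteq> 0" "emeasure (bernoulli_product \<rho>) V \<noteq> \<infinity>"
proof -
  interpret prob_space "bernoulli_product \<rho>" by (rule prob_space_bernoulli_product)
  show "emeasure (bernoulli_product \<rho>) V \<noteq> 0" "emeasure (bernoulli_product \<rho>) V \<noteq> \<infinity>"
    using measure_V_pos[OF assms] by (auto simp: emeasure_eq_measure)
qed

lemma prob_space_cond_bernoulli: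
  assumes "0 < \<rho>" "\<rho> < 1 / 2"
  shows "prob_space (cond_bernoulli \<rho>)"
  unfolding cond_bernoulli_def using emeasure_V[OF assms] by (rule prob_space_uniform_measure)

lemma AE_full_records:
  assumes "0 < \<rho>" "\<rho> < 1 / 2"
  shows "AE \<eta> in cond_bernoulli \<rho>. \<eta> \<in> V \<and> \<eta> \<in> full_records"
  unfolding cond_bernoulli_def
proof (rule AE_uniform_measureI)
  show "AE \<eta> in bernoulli_product \<rho>. \<eta> \<in> V \<longrightarrow> \<eta> \<in> V \<and> \<eta> \<in> full_records"
    using AE_ex_record_at_level[OF assms] by eventually_elim (simp add: V_def full_records_def)
qed simp

text \<open>Up to a null set the numerator of the conditional probability is the chain event, whose
  factor for \<open>V\<close> cancels.\<close>

lemma measure_gaps_interval: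
  assumes \<rho>: "0 < \<rho>" "\<rho> < 1 / 2" and ml: "m \<le> 0" "0 \<le> l"
  shows "measure (cond_bernoulli \<rho>) {\<eta>. \<forall>k\<in>{m..<l}. gap k \<eta> = a k} =
    (\<Prod>k\<in>{m..<l}. measure (bernoulli_product \<rho>) (passage 0 (a k)))"
proof -
  let ?C = "{\<eta>. gap_sum a m \<in> records \<eta>} \<inter> {\<eta>. \<forall>k\<in>{m..<l}. \<eta> \<in> passage (gap_sum a k) (gap_sum a (k + 1))}"
  let ?E = "{\<eta>. \<forall>k\<in>{m..<l}. gap k \<eta> = a k}"
  have E [measurable]: "?E \<in> sets (bernoulli_product \<rho>)"
  proof -
    have "?E = {\<eta> \<in> space (bernoulli_product \<rho>). \<forall>k\<in>{m..<l}. gap k \<eta> = a k}" by simp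
    also have "\<dots> \<in> sets (bernoulli_product \<rho>)" by measurable
    finally show ?thesis .
  qed
  have C: "?C \<in> sets (bernoulli_product \<rho>)"
  proof -
    have "?C = {\<eta> \<in> space (bernoulli_product \<rho>). gap_sum a m \<in> records \<eta> \<and>
        (\<forall>k\<in>{m..<l}. \<eta> \<in> passage (gap_sum a k) (gap_sum a (k + 1)))}" by auto
    also have "\<dots> \<in> sets (bernoulli_product \<rho>)" by measurable
    finally show ?thesis .
  qed
  have "measure (cond_bernoulli \<rho>) ?E = measure (bernoulli_product \<rho>) (V \<inter> ?E) / measure (bernoulli_product \<rho>) V"
    unfolding cond_bernoulli_def using emeasure_V[OF \<rho>] E by (rule measure_uniform_measure)
  also have "measure (bernoulli_product \<rho>) (V \<inter> ?E) = measure (bernoulli_product \<rho>) ?C"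
  proof (rule measure_eq_AE)
    show "AE \<eta> in bernoulli_product \<rho>. \<eta> \<in> V \<inter> ?E \<longleftrightarrow> \<eta> \<in> ?C"
      using AE_ex_record_at_level[OF \<rho>]
    proof eventually_elim
      case (elim \<eta>)
      show ?case
      proof (cases "\<eta> \<in> V")
        case True
        then have "\<eta> \<in> full_records" using elim by (simp add: V_def full_records_def)
        then show ?thesis using gaps_eq_iff[of \<eta> m l a] ml True by simp
      next
        case False
        \<comment> \<open>Off \<open>V\<close> both sides fail: a chain would make
          \<open>gap_sum a 0 = 0\<close> a record.\<close>
        then show ?thesis using passage_chain_records[of a m \<eta> l 0] ml
          by (auto simp: V_def gap_sum_0)
      qed
    qed
  qed (use C E in simp_all)
  also have "\<dots> = measure (bernoulli_product \<rho>) V * (\<Prod>k\<in>{m..<l}. measure (bernoulli_product \<rho>) (passage 0 (a k)))"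
    using ml by (intro measure_passage_chain) simp
  finally show ?thesis using measure_V_pos[OF \<rho>] by simp
qed

text \<open>The weights are the law of \<open>gap 0\<close> under the conditioned measure, hence sum
  to 1.\<close>

lemma nn_integral_measure_passage:
  assumes "0 < \<rho>" "\<rho> < 1 / 2"
  shows "(\<integral>\<^sup>+b. ennreal (measure (bernoulli_product \<rho>) (passage 0 b)) \<partial>count_space UNIV) = 1"
proof -
  interpret prob_space "cond_bernoulli \<rho>" by (rule prob_space_cond_bernoulli[OF assms])
  have gap: "measure (bernoulli_product \<rho>) (passage 0 b) = prob (gap 0 -` {b} \<inter> space (cond_bernoulli \<rho>))" for b
  proof -
    have "{0..<1} = {0::int}" by auto
    then show ?thesis
      using measure_gaps_interval[OF assms, of 0 1 "\<lambda>_. b"] by (simp add: vimage_def)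
  qed
  have "(\<integral>\<^sup>+b. ennreal (measure (bernoulli_product \<rho>) (passage 0 b)) \<partial>count_space UNIV) =
      (\<integral>\<^sup>+b. emeasure (cond_bernoulli \<rho>) (gap 0 -` {b} \<inter> space (cond_bernoulli \<rho>)) \<partial>count_space UNIV)"
    by (simp add: gap emeasure_eq_measure)
  also have "\<dots> = emeasure (cond_bernoulli \<rho>) (\<Union>b. gap 0 -` {b} \<inter> space (cond_bernoulli \<rho>))"
    by (rule emeasure_UN_countable[symmetric])
      (auto simp: disjoint_family_on_def simp del: space_cond_bernoulli intro!: measurable_sets[where A = "count_space UNIV"])
  also have "(\<Union>b. gap 0 -` {b} \<inter> space (cond_bernoulli \<rho>)) = space (cond_bernoulli \<rho>)" by auto
  finally show ?thesis by (simp only: emeasure_space_1)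
qed

lemma measure_gaps:
  assumes \<rho>: "0 < \<rho>" "\<rho> < 1 / 2" and "finite J"
  shows "measure (cond_bernoulli \<rho>) {\<eta> \<in> space (cond_bernoulli \<rho>). \<forall>k\<in>J. gap k \<eta> = a k} =
    (\<Prod>k\<in>J. measure (bernoulli_product \<rho>) (passage 0 (a k)))"
proof -
  interpret prob_space "cond_bernoulli \<rho>" by (rule prob_space_cond_bernoulli[OF \<rho>])
  \<comment> \<open>An interval around \<open>J\<close> and 0; its right end is the maximum plus 1
    because it is half-open.\<close>
  obtain m l where ml: "m \<le> 0" "0 \<le> l" "J \<subseteq> {m..<l}"
  proof
    have bounds: "Min (insert 0 J) \<le> k \<and> k \<le> Max (insert 0 J)" if "k \<in> insert 0 J" for k
      using \<open>finite J\<close> that by (intro conjI Min_le Max_ge) simp_all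
    show "Min (insert 0 J) \<le> 0" "0 \<le> Max (insert 0 J) + 1"
      using bounds[of 0] by simp_all
    show "J \<subseteq> {Min (insert 0 J)..<Max (insert 0 J) + 1}"
    proof
      fix k assume "k \<in> J"
      then show "k \<in> {Min (insert 0 J)..<Max (insert 0 J) + 1}" using bounds[of k] by force
    qed
  qed
  show ?thesis
  proof (rule prob_all_eq_subset[where L = "{m..<l}"])
    show "prob {\<eta> \<in> space (cond_bernoulli \<rho>). \<forall>k\<in>J \<union> {m..<l}. gap k \<eta> = a k} =
        (\<Prod>k\<in>J \<union> {m..<l}. measure (bernoulli_product \<rho>) (passage 0 (a k)))" for a
      using measure_gaps_interval[OF \<rho> ml(1,2), of a] by (simp add: Un_absorb1[OF ml(3)])
    show "gap i \<in> measurable (cond_bernoulli \<rho>) (count_space UNIV)" for i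
      by measurable
  qed (simp_all add: \<open>finite J\<close> nn_integral_measure_passage[OF \<rho>])
qed

text \<open>The almost sure enumeration ensures that \<open>gap\<close> measures true distances
  between consecutive points and not a default of \<open>THE\<close>.\<close>

theorem theorem3p2:
  fixes \<rho> :: real
  assumes "0 < \<rho>" and "\<rho> < 1 / 2"
  shows "(AE \<eta> in cond_bernoulli \<rho>. \<eta> \<in> V \<and> is_enumeration (records \<eta>) (record_pos \<eta>)) \<and>
    prob_space.indep_vars (cond_bernoulli \<rho>) (\<lambda>_. count_space UNIV) gap UNIV \<and>
    (\<forall>j k. distr (cond_bernoulli \<rho>) (count_space UNIV) (gap j) =
           distr (cond_bernoulli \<rho>) (count_space UNIV) (gap k)) \<and>
    (\<forall>k n. measure (cond_bernoulli \<rho>) {\<eta> \<in> space (cond_bernoulli \<rho>). gap k \<eta> = 2 * int n + 1} =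
           catalan n * \<rho> ^ n * (1 - \<rho>) ^ (n + 1))"
proof (intro conjI allI)
  interpret prob_space "cond_bernoulli \<rho>" by (rule prob_space_cond_bernoulli[OF assms])
  have gap_meas: "gap k \<in> measurable (cond_bernoulli \<rho>) (count_space UNIV)" for k
    by measurable
  \<comment> \<open>The point masses of \<open>gap k\<close> do not depend on \<open>k\<close>,
    which gives the equality of laws.\<close>
  have single: "prob {\<eta> \<in> space (cond_bernoulli \<rho>). gap k \<eta> = b} = measure (bernoulli_product \<rho>) (passage 0 b)" for k b
    using measure_gaps[OF assms, of "{k}" "\<lambda>_. b"] by simp
  show "AE \<eta> in cond_bernoulli \<rho>. \<eta> \<in> V \<and> is_enumeration (records \<eta>) (record_pos \<eta>)"
    using AE_full_records[OF assms] by eventually_elim (simp add: full_records_record_pos(1))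
  show "indep_vars (\<lambda>_. count_space UNIV) gap UNIV"
    using gap_meas measure_gaps[OF assms] by (rule indep_vars_if_prob_all_eq)
  show "distr (cond_bernoulli \<rho>) (count_space UNIV) (gap j) = distr (cond_bernoulli \<rho>) (count_space UNIV) (gap k)" for j k
  proof (rule measure_eqI_countable[where A = UNIV])
    fix b
    have "emeasure (distr (cond_bernoulli \<rho>) (count_space UNIV) (gap k)) {b} = ennreal (measure (bernoulli_product \<rho>) (passage 0 b))" for k
      using single[of k b] by (simp add: emeasure_distr[OF gap_meas] emeasure_eq_measure vimage_def)
    then show "emeasure (distr (cond_bernoulli \<rho>) (count_space UNIV) (gap j)) {b} =
        emeasure (distr (cond_bernoulli \<rho>) (count_space UNIV) (gap k)) {b}" by simp
  qed simp_all
  show "prob {\<eta> \<in> space (cond_bernoulli \<rho>). gap k \<eta> = 2 * int n + 1} = catalan n * \<rho> ^ n * (1 - \<rho>) ^ (n + 1)" for k n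
    using assms unfolding single by (intro measure_passage_odd) auto
qed

end
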